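(* Let $G=(V,E)$ be a directed graph with vertex set $V=\{1,\dots,p\}$ whose edge set contains all self-loops $i\to i$, and let $S_G=\{(j,i): i\to j\in E\}$. Let $C=2I_p$ and let $M^0=\mathrm{diag}(-d_1,\dots,-d_p)$ be a stable diagonal matrix (i.e. $d_1,\dots,d_p>0$). Then the irrepresentability condition for support $S_G$ holds uniformly over a neighborhood of $M^0$ if and only if $$d_i<d_j\quad\text{for every edge } i\to j\in E \text{ with } i\neq j.$$ In particular, it is necessary that the graph $G$ is a DAG (disregarding self-loops).
   Context: $\mathrm{Stab}_p$ is the set of stable matrices in $\mathbb{R}^{p\times p}$ (all eigenvalues with strictly negative real part). For $M\in\mathrm{Stab}_p$ let $\Sigma=\Sigma(M)$ be the unique positive definite solution of the Lyapunov equation $M\Sigma+\Sigma M^\top+2I_p=0$, and let $S(M)=\{(j,k):M_{jk}\ne0\}$ be its support. $\mathrm{vec}$ stacks columns, and rows/columns of $p^2\times p^2$ matrices are indexed by pairs $(j,k)$ corresponding to the position of $M_{jk}$ in $\mathrm{vec}(M)$. $K^{(p,p)}$ is the commutation matrix, $K^{(p,p)}\mathrm{vec}(A)=\mathrm{vec}(A^\top)$. Define $$A(\Sigma)=(\Sigma\otimes I_p)+(I_p\otimes\Sigma)K^{(p,p)},\qquad\Gamma(\Sigma)=A(\Sigma)^\top A(\Sigma).$$ For $M\in\mathrm{Stab}_p$ with support $S=S(M)$ and $\Gamma=\Gamma(\Sigma(M))$, the irrepresentability constant is $\rho(M)=|\!|\!|\Gamma_{S^cS}(\Gamma_{SS})^{-1}|\!|\!|_\infty$,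 where $|\!|\!|B|\!|\!|_\infty=\max_i\sum_j|b_{ij}|$ and $S^c$ is the complement of $S$ in $\{1,\dots,p\}^2$; a bound on $\rho(M)$ includes the requirement that $\Gamma_{SS}$ be invertible. For a support set $S$ and $U\subset\mathrm{Stab}_p$, the irrepresentability condition for the support $S$ holds uniformly over $U$ if there exists $\alpha>0$ such that $\rho(M)\le1-\alpha$ for all $M\in U$ with $S(M)=S$. It holds uniformly over a neighborhood of $M^0$ if it holds uniformly over some set $U\subset\mathrm{Stab}_p$ that is a neighborhood of $M^0$. *)

theory Defs
  imports "HOL-Analysis.Analysis"
begin

text \<open>
  Vertices \<open>1, \<dots>, p\<close> are the elements of a finite type \<open>'n\<close> and \<open>p \<times> p\<close> matrices have type
  \<^typ>\<open>real^'n^'n\<close>; \<open>p\<^sup>2 \<times> p\<^sup>2\<close> matrices are indexed by pairs, \<open>(j, k)\<close> being the position of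
  \<open>M $ j $ k\<close> in the column-stacked vector.
\<close>

definition diagonal :: "('n \<Rightarrow> 'a::zero) \<Rightarrow> 'a^'n^'n" where
  "diagonal a = (\<chi> i j. if i = j then a i else 0)"

definition Stab :: "(real^'n^'n) set" where
  "Stab = {M. \<forall>(z::complex) (v::complex^'n).
      v \<noteq> 0 \<and> (\<chi> i j. complex_of_real (M $ i $ j)) *v v = z *s v \<longrightarrow> Re z < 0}"

definition pos_def :: "real^'n^'n \<Rightarrow> bool" where
  "pos_def A \<longleftrightarrow> transpose A = A \<and> (\<forall>x. x \<noteq> 0 \<longrightarrow> x \<bullet> (A *v x) > 0)"

definition lyapunov_sol :: "real^'n^'n \<Rightarrow> real^'n^'n" where
  "lyapunov_sol M =
     (THE \<Sigma>. pos_def \<Sigma> \<and> M ** \<Sigma> + \<Sigma> ** transpose M + 2 *\<^sub>R mat 1 = 0)"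

definition supp :: "real^'n^'n \<Rightarrow> ('n \<times> 'n) set" where
  "supp M = {(j, k). M $ j $ k \<noteq> 0}"

definition vec_cols :: "real^'n^'n \<Rightarrow> real^('n::finite \<times> 'n)" where
  "vec_cols M = (\<chi> jk. M $ fst jk $ snd jk)"

text \<open>
  Under column stacking, position \<open>(j, k)\<close> is entry \<open>j\<close> of block \<open>k\<close>, so the second components of
  the index pairs select the entry of the left factor of a Kronecker product (see
  \<open>kron_vec_cols\<close>).
\<close>

definition kron :: "real^'n^'n \<Rightarrow> real^'n^'n \<Rightarrow> real^('n::finite \<times> 'n)^('n \<times> 'n)" where
  "kron A B = (\<chi> jk lm. A $ snd jk $ snd lm * B $ fst jk $ fst lm)"

definition commutation :: "real^('n::finite \<times> 'n)^('n \<times> 'n)" where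
  "commutation = (\<chi> jk lm. if jk = prod.swap lm then 1 else 0)"

definition A_mat :: "real^'n^'n \<Rightarrow> real^('n::finite \<times> 'n)^('n \<times> 'n)" where
  "A_mat \<Sigma> = kron \<Sigma> (mat 1) + kron (mat 1) \<Sigma> ** commutation"

definition Gamma_mat :: "real^'n^'n \<Rightarrow> real^('n::finite \<times> 'n)^('n \<times> 'n)" where
  "Gamma_mat \<Sigma> = transpose (A_mat \<Sigma>) ** A_mat \<Sigma>"

lemma kron_vec_cols:
  "kron A B *v vec_cols X = vec_cols (B ** X ** transpose A)"
proof -
  have "(\<Sum>l\<in>UNIV. \<Sum>m\<in>UNIV. A $ k $ m * B $ j $ l * X $ l $ m) =
        (\<Sum>m\<in>UNIV. (\<Sum>l\<in>UNIV. B $ j $ l * X $ l $ m) * A $ k $ m)" for j k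
    by (subst sum.swap) (simp add: sum_distrib_right sum_distrib_left mult_ac)
  then show ?thesis
    by (simp add: vec_eq_iff kron_def vec_cols_def matrix_vector_mult_def matrix_matrix_mult_def
        transpose_def sum.cartesian_product' flip: UNIV_Times_UNIV)
qed

lemma commutation_vec_cols: "commutation *v vec_cols A = vec_cols (transpose A)"
proof -
  have "(\<Sum>lm\<in>UNIV. (if jk = prod.swap lm then 1 else 0) * A $ fst lm $ snd lm) =
        A $ snd jk $ fst jk" for jk :: "'a \<times> 'a"
  proof -
    have "(\<Sum>lm\<in>UNIV. (if jk = prod.swap lm then 1 else 0) * A $ fst lm $ snd lm) =
          (\<Sum>lm\<in>UNIV. if lm = prod.swap jk then A $ fst lm $ snd lm else 0)"
      by (rule sum.cong) auto
    then show ?thesis by simp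
  qed
  then show ?thesis
    by (simp add: vec_eq_iff commutation_def vec_cols_def matrix_vector_mult_def transpose_def)
qed

lemma A_mat_vec_cols:
  assumes "transpose \<Sigma> = \<Sigma>"
  shows "A_mat \<Sigma> *v vec_cols M = vec_cols (M ** \<Sigma> + \<Sigma> ** transpose M)"
proof -
  have "A_mat \<Sigma> *v vec_cols M =
        vec_cols (M ** \<Sigma>) + vec_cols (\<Sigma> ** transpose M)"
    by (simp add: A_mat_def matrix_vector_mult_add_rdistrib kron_vec_cols commutation_vec_cols
        assms flip: matrix_vector_mul_assoc)
  then show ?thesis
    by (simp add: vec_eq_iff vec_cols_def)
qed

text \<open>
  The submatrix with rows \<open>I\<close> and columns \<open>J\<close>, extended by zero to a full matrix. Products of
  such matrices with matching inner index set are the zero-extended products of the submatrices,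
  and the identity on \<open>S\<close> is \<open>submat S S (mat 1)\<close>.
\<close>

definition submat :: "'m set \<Rightarrow> 'n set \<Rightarrow> real^'n^'m \<Rightarrow> real^'n^'m" where
  "submat I J B = (\<chi> i j. if i \<in> I \<and> j \<in> J then B $ i $ j else 0)"

definition is_submat_inv :: "'m set \<Rightarrow> real^'m^'m \<Rightarrow> real^'m^'m \<Rightarrow> bool" where
  "is_submat_inv S B C \<longleftrightarrow> submat S S C = C \<and>
     submat S S B ** C = submat S S (mat 1) \<and> C ** submat S S B = submat S S (mat 1)"

definition submat_invertible :: "'m set \<Rightarrow> real^'m^'m \<Rightarrow> bool" where
  "submat_invertible S B \<longleftrightarrow> (\<exists>C. is_submat_inv S B C)"

definition submat_inv :: "'m set \<Rightarrow> real^'m^'m \<Rightarrow> real^'m^'m" where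
  "submat_inv S B = (THE C. is_submat_inv S B C)"

text \<open>
  On a zero-extended submatrix the additional zero rows do not change the value; if the
  submatrix has no rows, the value is \<open>0\<close>.
\<close>

definition row_sum_norm :: "real^'n^'m \<Rightarrow> real" where
  "row_sum_norm B = Max (range (\<lambda>i. \<Sum>j\<in>UNIV. \<bar>B $ i $ j\<bar>))"

text \<open>Only meaningful if the submatrix of \<open>\<Gamma>\<close> with rows and columns in the support is invertible.\<close>

definition irrep_const :: "real^'n^'n \<Rightarrow> real" where
  "irrep_const M = (let S = supp M; \<Gamma> = Gamma_mat (lyapunov_sol M)
     in row_sum_norm (submat (- S) S \<Gamma> ** submat_inv S \<Gamma>))"

definition irrep_const_le :: "real^'n^'n \<Rightarrow> real \<Rightarrow> bool" where
  "irrep_const_le M c \<longleftrightarrow>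
     submat_invertible (supp M) (Gamma_mat (lyapunov_sol M)) \<and> irrep_const M \<le> c"

definition irrep_uniform :: "('n \<times> 'n) set \<Rightarrow> (real^'n^'n) set \<Rightarrow> bool" where
  "irrep_uniform S U \<longleftrightarrow>
     (\<exists>\<alpha>>0. \<forall>M\<in>U. supp M = S \<longrightarrow> irrep_const_le M (1 - \<alpha>))"

definition irrep_uniform_near :: "('n \<times> 'n) set \<Rightarrow> real^'n^'n \<Rightarrow> bool" where
  "irrep_uniform_near S M0 \<longleftrightarrow>
     (\<exists>U. U \<subseteq> Stab \<and> M0 \<in> interior U \<and> irrep_uniform S U)"

definition graph_supp :: "('n \<times> 'n) set \<Rightarrow> ('n \<times> 'n) set" where
  "graph_supp E = {(j, i) | i j. (i, j) \<in> E}"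

end

theory Submission
  imports Defs
begin

text \<open>
  At \<open>M\<^sup>0 = diag(-d\<^sub>1, \<dots>, -d\<^sub>p)\<close> the Lyapunov equation has the solution
  \<open>\<Sigma>\<^sup>0 = diag(1/d\<^sub>1, \<dots>, 1/d\<^sub>p)\<close>, and \<open>\<Sigma>(M)\<close> depends continuously on \<open>M\<close> near \<open>M\<^sup>0\<close>. Both
  directions therefore reduce to computations with \<open>\<Sigma>\<^sup>0\<close>.

  Necessity. The columns of \<open>A(\<Sigma>)\<close> are dependent: \<open>A(\<Sigma>) vec(N) = vec(N\<Sigma> + (N\<Sigma>)\<^sup>T)\<close> vanishes for
  \<open>N = K \<Sigma>\<^sup>-\<^sup>1\<close> with \<open>K\<close> skew-symmetric. If \<open>n\<close> is a kernel vector of \<open>\<Gamma>\<close>, the \<open>S\<close>-columns of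
  \<open>n\<^sup>T \<Gamma> = 0\<close> express \<open>n\<^sub>S\<close> through \<open>n\<close> on the complement of \<open>S\<close> and the matrix
  \<open>\<Gamma>\<^bsub>S\<^sup>cS\<^esub> \<Gamma>\<^bsub>SS\<^esub>\<^sup>-\<^sup>1\<close>, so that the 1-norm of \<open>n\<close> on \<open>S\<close> is at most \<open>\<rho>(M)\<close> times its 1-norm off
  \<open>S\<close> (\<open>left_kernel_bound\<close>). This inequality contains no inverse and survives the limit
  \<open>M \<rightarrow> M\<^sup>0\<close>, whether or not \<open>\<Gamma>\<^bsub>SS\<^esub>\<close> becomes singular there. For \<open>(j, k) \<in> S\<close> and
  \<open>K = e\<^sub>j e\<^sub>k\<^sup>T - e\<^sub>k e\<^sub>j\<^sup>T\<close> the limit of \<open>N\<close> has entries \<open>d\<^sub>k\<close> at \<open>(j, k)\<close> and \<open>-d\<^sub>j\<close> at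
  \<open>(k, j)\<close>. If \<open>(k, j)\<close> is outside \<open>S\<close>, this gives \<open>d\<^sub>k \<le> (1 - \<alpha>) d\<^sub>j\<close>; if it is inside, it gives the
  absurd \<open>d\<^sub>k + d\<^sub>j \<le> 0\<close>.

  Sufficiency. If \<open>d\<close> increases along the edges, there are no 2-cycles, and \<open>\<Gamma>(\<Sigma>\<^sup>0)\<close>, which only
  couples a position with its transpose, is diagonal on \<open>S\<close>. Then
  \<open>\<Gamma>\<^bsub>S\<^sup>cS\<^esub> \<Gamma>\<^bsub>SS\<^esub>\<^sup>-\<^sup>1\<close> at \<open>\<Sigma>\<^sup>0\<close> has at most one nonzero entry in each row, a quotient
  \<open>d\<^sub>k / d\<^sub>j < 1\<close>, and by continuity its row sums stay below a constant less than 1 near \<open>M\<^sup>0\<close>.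

  Every continuity statement (for \<open>\<Sigma>\<close>, for \<open>K \<Sigma>\<^sup>-\<^sup>1\<close>, and for
  \<open>\<Gamma>\<^bsub>S\<^sup>cS\<^esub> \<Gamma>\<^bsub>SS\<^esub>\<^sup>-\<^sup>1\<close>) is an instance of \<open>tendsto_solution\<close>.
\<close>

section \<open>Equations depending continuously on a parameter\<close>

text \<open>
  An injective linear map on a finite-dimensional space is bounded below by some \<open>b\<close>. A change of
  the parameter perturbs the map by an operator of small norm, here at most \<open>b / 2\<close>.
\<close>

lemma eventually_bounded_below:
  fixes f :: "'a::real_normed_vector \<Rightarrow> 'b::euclidean_space \<Rightarrow> 'b"
  assumes "bounded_bilinear f" and "inj (f a0)"
  shows "\<exists>c>0. \<forall>\<^sub>F a in nhds a0. \<forall>x. c * norm x \<le> norm (f a x)"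
proof -
  interpret f: bounded_bilinear f by fact
  have "linear (f a0)"
    using f.bounded_linear_right bounded_linear.linear by blast
  from linear_inj_bounded_below_pos[OF this assms(2)] obtain b
    where b: "b > 0" "\<And>x. b * norm x \<le> norm (f a0 x)" by blast
  obtain K where K: "K > 0" "\<And>a x. norm (f a x) \<le> norm a * norm x * K"
    using f.pos_bounded by blast
  have "\<forall>\<^sub>F a in nhds a0. dist a a0 < b / (2 * K)"
    using b(1) K(1) by (intro eventually_nhds_metric[THEN iffD2] exI[of _ "b / (2 * K)"]) auto
  then have "\<forall>\<^sub>F a in nhds a0. \<forall>x. b / 2 * norm x \<le> norm (f a x)"
  proof (eventually_elim, intro allI)
    fix a x assume a: "dist a a0 < b / (2 * K)"
    have "norm (f (a - a0) x) \<le> norm (a - a0) * K * norm x"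
      using K(2)[of "a - a0" x] by (simp add: mult_ac)
    also have "\<dots> \<le> b / 2 * norm x"
      using a K(1) by (intro mult_right_mono) (auto simp: dist_norm field_simps)
    finally have "norm (f (a - a0) x) \<le> b / 2 * norm x" .
    moreover have "norm (f a0 x) \<le> norm (f a x) + norm (f (a - a0) x)"
      using norm_triangle_ineq4[of "f a x" "f (a - a0) x"] by (simp add: f.diff_left)
    ultimately show "b / 2 * norm x \<le> norm (f a x)"
      using b(2)[of x] by simp
  qed
  then show ?thesis using b(1) by (intro exI[of _ "b / 2"]) simp
qed

lemma eventually_bij_bilinear:
  fixes f :: "'a::real_normed_vector \<Rightarrow> 'b::euclidean_space \<Rightarrow> 'b"
  assumes "bounded_bilinear f" and "inj (f a0)"
  shows "\<forall>\<^sub>F a in nhds a0. bij (f a)"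
proof -
  obtain c where c: "c > 0" "\<forall>\<^sub>F a in nhds a0. \<forall>x. c * norm x \<le> norm (f a x)"
    using eventually_bounded_below[OF assms] by blast
  show ?thesis using c(2)
  proof eventually_elim
    case (elim a)
    have lin: "linear (f a)"
      using assms(1) bounded_bilinear.bounded_linear_right bounded_linear.linear by blast
    have "x = 0" if "f a x = 0" for x
    proof -
      have "c * norm x \<le> 0" using elim[rule_format, of x] that by simp
      then show ?thesis using c(1) by (simp add: mult_le_0_iff)
    qed
    then have "inj (f a)" using lin by (simp add: linear_injective_0)
    then show ?case by (simp add: bij_def lin linear_injective_imp_surjective)
  qed
qed

text \<open>
  With the uniform lower bound \<open>c\<close>, the error \<open>x t - x0\<close> is at most \<open>1 / c\<close> times the residual of
  \<open>x0\<close> in the equation at the parameter \<open>a t\<close>, and that residual tends to \<open>0\<close>.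
\<close>

lemma tendsto_solution:
  fixes f :: "'a::real_normed_vector \<Rightarrow> 'b::euclidean_space \<Rightarrow> 'b"
  assumes "bounded_bilinear f" and "inj (f a0)"
    and a: "(a \<longlongrightarrow> a0) F" and r: "(r \<longlongrightarrow> f a0 x0) F"
    and eq: "\<forall>\<^sub>F t in F. f (a t) (x t) = r t"
  shows "(x \<longlongrightarrow> x0) F"
proof -
  interpret f: bounded_bilinear f by fact
  obtain c where c: "c > 0" "\<forall>\<^sub>F a in nhds a0. \<forall>x. c * norm x \<le> norm (f a x)"
    using eventually_bounded_below[OF assms(1,2)] by blast
  have "\<forall>\<^sub>F t in F. \<forall>x. c * norm x \<le> norm (f (a t) x)"
    using c(2) a by (rule eventually_compose_filterlim)
  with eq have "\<forall>\<^sub>F t in F. norm (x t - x0) \<le> norm (r t - f (a t) x0) / c"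
  proof eventually_elim
    case (elim t)
    have "c * norm (x t - x0) \<le> norm (f (a t) (x t - x0))" using elim(2) by blast
    also have "\<dots> = norm (r t - f (a t) x0)" using elim(1) by (simp add: f.diff_right)
    finally show ?case using c(1) by (simp add: field_simps)
  qed
  moreover have "((\<lambda>t. norm (r t - f (a t) x0) / c) \<longlongrightarrow> norm (f a0 x0 - f a0 x0) / c) F"
    by (intro tendsto_intros r f.tendsto a) (use c(1) in auto)
  then have "((\<lambda>t. norm (r t - f (a t) x0) / c) \<longlongrightarrow> 0) F" by simp
  ultimately have "((\<lambda>t. x t - x0) \<longlongrightarrow> 0) F"
    by (rule Lim_null_comparison)
  then show ?thesis by (simp add: LIM_zero_cancel)
qed

section \<open>Matrix preliminaries\<close>

lemma transpose_add: "transpose (A + B) = transpose A + transpose (B::real^'n^'m)"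
  by (simp add: transpose_def vec_eq_iff)

lemma bounded_bilinear_matrix_mult:
  "bounded_bilinear ((**) :: real^'n^'n \<Rightarrow> real^'n^'n \<Rightarrow> real^'n^'n)"
  unfolding bilinear_conv_bounded_bilinear[symmetric] bilinear_def
  by (auto intro!: linearI simp: matrix_matrix_mult_def vec_eq_iff algebra_simps sum.distrib
      sum_distrib_left)

lemma bounded_bilinear_matrix_mult_flip:
  "bounded_bilinear (\<lambda>(A :: real^'n^'n) (B :: real^'n^'n). B ** A)"
  by (rule bounded_bilinear.flip[OF bounded_bilinear_matrix_mult])

lemma tendsto_matrix_iff:
  fixes A :: "'a \<Rightarrow> real^'n^'m"
  shows "(A \<longlongrightarrow> L) F \<longleftrightarrow> (\<forall>i j. ((\<lambda>t. A t $ i $ j) \<longlongrightarrow> L $ i $ j) F)"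
proof
  assume "\<forall>i j. ((\<lambda>t. A t $ i $ j) \<longlongrightarrow> L $ i $ j) F"
  then show "(A \<longlongrightarrow> L) F" by (intro vec_tendstoI) auto
qed (auto intro!: tendsto_vec_nth)

lemma matrix_mult_diagonal:
  fixes A :: "real^'n^'m"
  shows "(A ** diagonal a) $ i $ j = A $ i $ j * a j"
  by (simp add: matrix_matrix_mult_def diagonal_def mult_delta_right)

lemma diagonal_matrix_mult:
  fixes A :: "real^'n^'m"
  shows "(diagonal a ** A) $ i $ j = a i * A $ i $ j"
  by (simp add: matrix_matrix_mult_def diagonal_def mult_delta_left)

lemma transpose_diagonal [simp]: "transpose (diagonal a) = diagonal a"
  by (auto simp: transpose_def diagonal_def vec_eq_iff)

lemma inj_mult_diagonal:
  assumes "\<And>i. a i \<noteq> 0"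
  shows "inj (\<lambda>B :: real^'n^'n. B ** diagonal a)"
  by (rule injI) (use assms in \<open>auto simp: vec_eq_iff matrix_mult_diagonal\<close>)

section \<open>The Lyapunov equation near a diagonal matrix\<close>

lemma bounded_bilinear_lyapunov:
  "bounded_bilinear (\<lambda>M X. M ** X + X ** transpose M :: real^'n^'n)"
  unfolding bilinear_conv_bounded_bilinear[symmetric] bilinear_def
  by (auto intro!: linearI simp: matrix_matrix_mult_def vec_eq_iff transpose_def algebra_simps
      sum.distrib sum_distrib_left)

text \<open>
  The Lyapunov operator of \<open>diag(-d)\<close> multiplies the entry \<open>(i, j)\<close> by \<open>-(d i + d j)\<close>.
\<close>

lemma inj_lyapunov_diagonal:
  fixes d :: "'n::finite \<Rightarrow> real"
  assumes "\<forall>i. d i > 0"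
  shows "inj (\<lambda>X :: real^'n^'n. diagonal (\<lambda>i. - d i) ** X
           + X ** transpose (diagonal (\<lambda>i. - d i)))"
proof (rule injI)
  fix X Y :: "real^'n^'n"
  assume eq: "diagonal (\<lambda>i. - d i) ** X + X ** transpose (diagonal (\<lambda>i. - d i))
    = diagonal (\<lambda>i. - d i) ** Y + Y ** transpose (diagonal (\<lambda>i. - d i))"
  have "X $ i $ j = Y $ i $ j" for i j
  proof -
    have "(d i + d j) * X $ i $ j = (d i + d j) * Y $ i $ j"
      using arg_cong[OF eq, of "\<lambda>Z. Z $ i $ j"]
      by (simp add: matrix_mult_diagonal diagonal_matrix_mult algebra_simps)
    moreover have "d i + d j \<noteq> 0" using assms by (metis add_pos_pos less_irrefl)
    ultimately show ?thesis by simp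
  qed
  then show "X = Y" by (simp add: vec_eq_iff)
qed

lemma lyapunov_transpose:
  "transpose (M ** X + X ** transpose M :: real^'n^'n)
   = M ** transpose X + transpose X ** transpose M"
  by (simp add: transpose_add matrix_transpose_mul add.commute)

text \<open>
  The quadratic form of \<open>diagonal s\<close> is at least \<open>m \<bar>x\<bar>\<^sup>2\<close> with \<open>m = min s\<close>, and a perturbation whose
  entries are at most \<open>b\<close> changes it by at most \<open>p\<^sup>2 b \<bar>x\<bar>\<^sup>2\<close>.
\<close>

lemma eventually_pos_def:
  fixes s :: "'n::finite \<Rightarrow> real" and X :: "'a \<Rightarrow> real^'n^'n"
  assumes s: "\<forall>i. s i > 0" and lim: "(X \<longlongrightarrow> diagonal s) F"
    and sym: "\<forall>\<^sub>F t in F. transpose (X t) = X t"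
  shows "\<forall>\<^sub>F t in F. pos_def (X t)"
proof -
  define m where "m = Min (range s)"
  have m: "m > 0" "\<And>i. m \<le> s i" using s by (auto simp: m_def)
  define b where "b = m / (2 * real CARD('n) ^ 2)"
  have b: "b > 0" "real CARD('n) ^ 2 * b < m" using m(1) by (auto simp: b_def)
  have "\<forall>\<^sub>F t in F. \<bar>X t $ i $ j - diagonal s $ i $ j\<bar> < b" for i j
    using tendstoD[OF lim[unfolded tendsto_matrix_iff, rule_format] b(1), of i j]
    by (simp add: dist_real_def)
  then have "\<forall>\<^sub>F t in F. \<forall>i j. \<bar>X t $ i $ j - diagonal s $ i $ j\<bar> < b"
    by (intro eventually_all_finite)
  with sym show ?thesis
  proof eventually_elim
    case (elim t)
    define D where "D = X t - diagonal s"
    have D: "\<bar>D $ i $ j\<bar> \<le> b" for i j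
      using elim(2)[rule_format, of i j] by (simp add: D_def)
    have "x \<bullet> (X t *v x) > 0" if "x \<noteq> 0" for x
    proof -
      have "\<bar>x \<bullet> (D *v x)\<bar> = \<bar>\<Sum>i\<in>UNIV. \<Sum>j\<in>UNIV. x $ i * (D $ i $ j * x $ j)\<bar>"
        by (simp add: inner_vec_def matrix_vector_mult_def sum_distrib_left)
      also have "\<dots> \<le> (\<Sum>i\<in>UNIV. \<Sum>j\<in>UNIV. \<bar>x $ i * (D $ i $ j * x $ j)\<bar>)"
        by (intro order_trans[OF sum_abs] sum_mono order_refl)
      also have "\<dots> \<le> (\<Sum>i\<in>(UNIV::'n set). \<Sum>j\<in>(UNIV::'n set). norm x * (b * norm x))"
        unfolding abs_mult
        by (intro sum_mono mult_mono D component_le_norm_cart) (use b in auto)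
      also have "\<dots> = real CARD('n) ^ 2 * b * (norm x)\<^sup>2"
        by (simp add: power2_eq_square)
      also have "\<dots> < m * (norm x)\<^sup>2"
        using b(2) that by (intro mult_strict_right_mono) auto
      finally have small: "\<bar>x \<bullet> (D *v x)\<bar> < m * (norm x)\<^sup>2" .
      have dx: "(diagonal s *v x) $ i = s i * x $ i" for i
        by (simp add: matrix_vector_mult_def diagonal_def mult_delta_left)
      have "m * (norm x)\<^sup>2 = (\<Sum>i\<in>UNIV. m * (x $ i * x $ i))"
        by (simp add: power2_norm_eq_inner inner_vec_def sum_distrib_left)
      also have "\<dots> \<le> (\<Sum>i\<in>UNIV. s i * (x $ i * x $ i))"
        by (intro sum_mono mult_right_mono m) auto
      also have "\<dots> = x \<bullet> (diagonal s *v x)"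
        by (simp add: inner_vec_def dx mult_ac)
      finally have "m * (norm x)\<^sup>2 \<le> x \<bullet> (diagonal s *v x)" .
      moreover have "X t *v x = diagonal s *v x + D *v x"
        by (simp add: D_def flip: matrix_vector_mult_add_rdistrib)
      ultimately show ?thesis using small by (simp add: inner_add_right)
    qed
    with elim(1) show ?case by (simp add: pos_def_def)
  qed
qed

text \<open>
  Near \<open>diag(-d)\<close> the Lyapunov operator is bijective, so the equation has a single solution
  \<open>X M\<close> among all matrices. It is symmetric because its transpose solves the same equation, and
  positive definite because it is close to \<open>diag(1 / d)\<close>; hence it is the one that
  \<^const>\<open>lyapunov_sol\<close> selects.
\<close>

lemma lyapunov_sol_near_diagonal:
  fixes d :: "'n::finite \<Rightarrow> real"
  assumes d: "\<forall>i. d i > 0"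
  shows "\<forall>\<^sub>F M in nhds (diagonal (\<lambda>i. - d i)).
           transpose (lyapunov_sol M) = lyapunov_sol M"
    and "(lyapunov_sol \<longlongrightarrow> diagonal (\<lambda>i. 1 / d i)) (nhds (diagonal (\<lambda>i. - d i)))"
proof -
  define f where "f = (\<lambda>M X. M ** X + X ** transpose M :: real^'n^'n)"
  define M0 :: "real^'n^'n" where "M0 = diagonal (\<lambda>i. - d i)"
  define R :: "real^'n^'n" where "R = - (2 *\<^sub>R mat 1)"
  define X where "X M = inv (f M) R" for M
  have bb: "bounded_bilinear f" and inj: "inj (f M0)"
    unfolding f_def M0_def by (fact bounded_bilinear_lyapunov, fact inj_lyapunov_diagonal[OF d])
  have bij: "\<forall>\<^sub>F M in nhds M0. bij (f M)"
    by (rule eventually_bij_bilinear[OF bb inj])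
  have X: "f M Y = R \<longleftrightarrow> Y = X M" if "bij (f M)" for M Y
    unfolding X_def using bij_inv_eq_iff[OF that, of Y R] by blast
  have sym: "transpose (X M) = X M" if "bij (f M)" for M
  proof -
    have "f M (transpose (X M)) = transpose (f M (X M))"
      by (simp add: f_def lyapunov_transpose)
    also have "f M (X M) = R" using X[OF that] by blast
    also have "transpose R = R" by (auto simp: R_def transpose_def mat_def vec_eq_iff)
    finally show ?thesis using X[OF that] by blast
  qed
  have "f M0 (diagonal (\<lambda>i. 1 / d i)) $ i $ j = R $ i $ j" for i j
    using d[rule_format, of i]
    by (simp add: f_def M0_def R_def matrix_mult_diagonal) (auto simp: diagonal_def mat_def)
  then have \<Sigma>0: "f M0 (diagonal (\<lambda>i. 1 / d i)) = R" by (simp add: vec_eq_iff)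
  have limX: "(X \<longlongrightarrow> diagonal (\<lambda>i. 1 / d i)) (nhds M0)"
  proof (rule tendsto_solution[OF bb inj filterlim_ident])
    show "((\<lambda>_. R) \<longlongrightarrow> f M0 (diagonal (\<lambda>i. 1 / d i))) (nhds M0)"
      unfolding \<Sigma>0 by (rule tendsto_const)
    show "\<forall>\<^sub>F M in nhds M0. f M (X M) = R"
      using bij by (rule eventually_mono) (use X in blast)
  qed
  have "\<forall>\<^sub>F M in nhds M0. pos_def (X M)"
    by (rule eventually_pos_def[OF _ limX eventually_mono[OF bij sym]]) (use d in simp)
  with bij have ev: "\<forall>\<^sub>F M in nhds M0. lyapunov_sol M = X M \<and> transpose (X M) = X M"
  proof eventually_elim
    case (elim M)
    have "M ** Y + Y ** transpose M + 2 *\<^sub>R mat 1 = 0 \<longleftrightarrow> f M Y = R" for Y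
      by (simp add: f_def R_def eq_neg_iff_add_eq_0)
    then have "lyapunov_sol M = X M"
      unfolding lyapunov_sol_def using elim X[OF elim(1)] by (intro the_equality) auto
    with sym[OF elim(1)] show ?case by simp
  qed
  show "\<forall>\<^sub>F M in nhds (diagonal (\<lambda>i. - d i)). transpose (lyapunov_sol M) = lyapunov_sol M"
    using ev unfolding M0_def by eventually_elim simp
  show "(lyapunov_sol \<longlongrightarrow> diagonal (\<lambda>i. 1 / d i)) (nhds (diagonal (\<lambda>i. - d i)))"
    using limX unfolding M0_def[symmetric]
    by (rule Lim_transform_eventually) (rule eventually_mono[OF ev], simp)
qed

section \<open>Stability near a diagonal matrix\<close>

text \<open>
  Gershgorin's argument: by the row of an eigenvector's largest component, every eigenvalue lies
  in a disc around a diagonal entry that is contained in the left half-plane.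
\<close>

lemma diagonally_dominant_Stab:
  fixes M :: "real^'n^'n"
  assumes dom: "\<And>i. M $ i $ i + (\<Sum>j\<in>- {i}. \<bar>M $ i $ j\<bar>) < 0"
  shows "M \<in> Stab"
  unfolding Stab_def
proof (intro CollectI allI impI, elim conjE)
  fix z :: complex and v :: "complex^'n"
  assume v: "v \<noteq> 0" and ev: "(\<chi> i j. complex_of_real (M $ i $ j)) *v v = z *s v"
  have "Max (range (\<lambda>j. cmod (v $ j))) \<in> range (\<lambda>j. cmod (v $ j))" by (rule Max_in) auto
  then obtain i where "cmod (v $ i) = Max (range (\<lambda>j. cmod (v $ j)))" by force
  then have i: "cmod (v $ j) \<le> cmod (v $ i)" for j by simp
  have vi: "cmod (v $ i) > 0"
  proof (rule ccontr)
    assume "\<not> ?thesis"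
    then have "cmod (v $ j) \<le> 0" for j using i[of j] by simp
    then have "v = 0" by (simp add: vec_eq_iff)
    with v show False ..
  qed
  have "z * v $ i = (\<Sum>j\<in>UNIV. of_real (M $ i $ j) * v $ j)"
    using arg_cong[OF ev, of "\<lambda>w. w $ i"] by (simp add: matrix_vector_mult_def)
  also have "\<dots> = of_real (M $ i $ i) * v $ i + (\<Sum>j\<in>- {i}. of_real (M $ i $ j) * v $ j)"
    by (simp add: sum.remove[of UNIV i] Compl_eq_Diff_UNIV)
  finally have "(z - of_real (M $ i $ i)) * v $ i = (\<Sum>j\<in>- {i}. of_real (M $ i $ j) * v $ j)"
    by (simp add: algebra_simps)
  then have "cmod (z - of_real (M $ i $ i)) * cmod (v $ i)
      = cmod (\<Sum>j\<in>- {i}. of_real (M $ i $ j) * v $ j)"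
    by (metis norm_mult)
  also have "\<dots> \<le> (\<Sum>j\<in>- {i}. \<bar>M $ i $ j\<bar> * cmod (v $ i))"
    by (intro sum_norm_le) (auto simp: norm_mult intro!: mult_left_mono i)
  also have "\<dots> = (\<Sum>j\<in>- {i}. \<bar>M $ i $ j\<bar>) * cmod (v $ i)"
    by (simp add: sum_distrib_right)
  finally have "cmod (z - of_real (M $ i $ i)) \<le> (\<Sum>j\<in>- {i}. \<bar>M $ i $ j\<bar>)"
    using vi by simp
  then show "Re z < 0"
    using dom[of i] abs_Re_le_cmod[of "z - of_real (M $ i $ i)"] by simp
qed

lemma eventually_Stab_diagonal:
  fixes d :: "'n::finite \<Rightarrow> real"
  assumes "\<forall>i. d i > 0"
  shows "\<forall>\<^sub>F M in nhds (diagonal (\<lambda>i. - d i)). M \<in> Stab"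
proof -
  let ?M0 = "diagonal (\<lambda>i. - d i) :: real^'n^'n"
  have "\<forall>\<^sub>F M in nhds ?M0. M $ i $ i + (\<Sum>j\<in>- {i}. \<bar>M $ i $ j\<bar>) < 0" for i
  proof (rule order_tendstoD(2))
    show "((\<lambda>M. M $ i $ i + (\<Sum>j\<in>- {i}. \<bar>M $ i $ j\<bar>))
        \<longlongrightarrow> ?M0 $ i $ i + (\<Sum>j\<in>- {i}. \<bar>?M0 $ i $ j\<bar>)) (nhds ?M0)"
      by (intro tendsto_intros filterlim_ident)
    have "(\<Sum>j\<in>- {i}. \<bar>?M0 $ i $ j\<bar>) = 0" by (auto simp: diagonal_def intro!: sum.neutral)
    then show "?M0 $ i $ i + (\<Sum>j\<in>- {i}. \<bar>?M0 $ i $ j\<bar>) < 0"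
      using assms by (simp add: diagonal_def)
  qed
  then have "\<forall>\<^sub>F M in nhds ?M0. \<forall>i. M $ i $ i + (\<Sum>j\<in>- {i}. \<bar>M $ i $ j\<bar>) < 0"
    by (rule eventually_all_finite)
  then show ?thesis by eventually_elim (auto intro: diagonally_dominant_Stab)
qed

section \<open>Inverses of principal submatrices\<close>

lemma submat_mat_1: "submat S S (mat 1) = diagonal (\<lambda>i. of_bool (i \<in> S))"
  by (auto simp: submat_def mat_def diagonal_def vec_eq_iff)

lemma submat_fixed_mult:
  assumes "submat S S C = C"
  shows "submat S S (mat 1) ** C = C" and "C ** submat S S (mat 1) = C"
    and "C ** submat (- S) (- S) (mat 1) = 0"
proof -
  have "C $ i $ j = (if i \<in> S \<and> j \<in> S then C $ i $ j else 0)" for i j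
    using arg_cong[OF assms, of "\<lambda>B. B $ i $ j"] by (simp add: submat_def)
  then have "C $ i $ j = 0" if "i \<notin> S \<or> j \<notin> S" for i j
    using that by (metis (full_types))
  then show "submat S S (mat 1) ** C = C" and "C ** submat S S (mat 1) = C"
    and "C ** submat (- S) (- S) (mat 1) = 0"
    by (auto simp: vec_eq_iff submat_mat_1 matrix_mult_diagonal diagonal_matrix_mult)
qed

lemma submat_inv_eq:
  assumes "is_submat_inv S B C"
  shows "submat_inv S B = C"
  unfolding submat_inv_def
proof (rule the_equality)
  show "is_submat_inv S B C" by fact
next
  fix C' assume C': "is_submat_inv S B C'"
  have "C' = C' ** (submat S S B ** C)"
    using assms C' submat_fixed_mult(2)[of S C'] by (simp add: is_submat_inv_def)
  also have "\<dots> = submat S S (mat 1) ** C"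
    using C' by (simp add: is_submat_inv_def matrix_mul_assoc)
  also have "\<dots> = C"
    using assms submat_fixed_mult(1)[of S C] by (simp add: is_submat_inv_def)
  finally show "C' = C" .
qed

text \<open>
  The block-diagonal matrix with blocks \<open>B\<^bsub>SS\<^esub>\<close> and the identity on the complement of \<open>S\<close>.
  The zero-extended submatrix is singular on the full space unless \<open>S\<close> is everything; this one is
  invertible exactly when \<open>B\<^bsub>SS\<^esub>\<close> is, so that full-space arguments apply to it.
\<close>

definition bordered :: "'m set \<Rightarrow> real^'m^'m \<Rightarrow> real^'m^'m" where
  "bordered S B = submat S S B + submat (- S) (- S) (mat 1)"

text \<open>
  The coordinate projection \<open>P\<close> onto \<open>S\<close> commutes with the bordered matrix, hence with its inverse
  \<open>X\<close>, and everything follows by multiplying with \<open>P\<close>.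
\<close>

lemma is_submat_inv_bordered:
  assumes "X ** bordered S B = mat 1"
  shows "is_submat_inv S B (submat S S X)"
proof -
  define G where "G = bordered S B"
  define P :: "real^'a^'a" where "P = submat S S (mat 1)"
  have XG: "X ** G = mat 1" and GX: "G ** X = mat 1"
    using assms matrix_left_right_inverse[of X "bordered S B"] by (auto simp: G_def)
  have P: "P ** P = P" "P ** G = submat S S B" "G ** P = submat S S B"
    by (auto simp: vec_eq_iff P_def G_def bordered_def submat_mat_1 matrix_mult_diagonal
        diagonal_matrix_mult) (auto simp: submat_def diagonal_def)
  have "P ** X = X ** (G ** P) ** X"
    by (simp add: matrix_mul_assoc XG)
  also have "\<dots> = X ** P"
    by (simp add: P(3) GX flip: P(2) matrix_mul_assoc)
  finally have comm: "P ** X = X ** P" .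
  have "submat S S X = P ** X ** P"
    by (auto simp: vec_eq_iff P_def submat_mat_1 matrix_mult_diagonal diagonal_matrix_mult)
      (auto simp: submat_def)
  then have C: "submat S S X = X ** P"
    by (simp add: comm P(1) flip: matrix_mul_assoc)
  have "submat S S B ** (X ** P) = G ** (P ** X) ** P"
    by (simp add: P(3)[symmetric] matrix_mul_assoc)
  also have "\<dots> = P"
    by (simp add: comm matrix_mul_assoc GX P(1))
  finally have 1: "submat S S B ** (X ** P) = P" .
  have "X ** P ** submat S S B = X ** (P ** P ** G)"
    by (simp add: P(2)[symmetric] matrix_mul_assoc)
  also have "\<dots> = P"
    by (simp add: P matrix_mul_assoc XG flip: P(3))
  finally have 2: "X ** P ** submat S S B = P" .
  have "submat S S (submat S S X) = submat S S X"
    by (simp add: submat_def vec_eq_iff)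
  with 1 2 show ?thesis by (simp add: is_submat_inv_def C P_def)
qed

text \<open>
  This characterises \<open>B\<^bsub>S\<^sup>cS\<^esub> B\<^bsub>SS\<^esub>\<^sup>-\<^sup>1\<close> as the solution of a linear equation on the full
  space, the form in which its continuity can be read off.
\<close>

lemma submat_inv_mult_bordered:
  assumes "is_submat_inv S B C"
  shows "(submat (- S) S B ** C) ** bordered S B = submat (- S) S B"
proof -
  have C: "submat S S C = C" "C ** submat S S B = submat S S (mat 1)"
    using assms by (auto simp: is_submat_inv_def)
  have "C ** bordered S B = submat S S (mat 1)"
    by (simp add: bordered_def matrix_add_ldistrib C submat_fixed_mult(3)[OF C(1)])
  then have "(submat (- S) S B ** C) ** bordered S B = submat (- S) S B ** submat S S (mat 1)"
    by (simp flip: matrix_mul_assoc)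
  also have "\<dots> = submat (- S) S B"
    by (auto simp: vec_eq_iff submat_mat_1 matrix_mult_diagonal) (auto simp: submat_def)
  finally show ?thesis .
qed

lemma row_sum_norm_le_iff: "row_sum_norm B \<le> c \<longleftrightarrow> (\<forall>i. (\<Sum>j\<in>UNIV. \<bar>B $ i $ j\<bar>) \<le> c)"
  by (auto simp: row_sum_norm_def)

text \<open>
  The \<open>S\<close>-columns of \<open>n\<^sup>T B = 0\<close>, multiplied by the inverse \<open>C\<close> of \<open>B\<^bsub>SS\<^esub>\<close>, say that \<open>n\<close> on
  \<open>S\<close> is \<open>-n\<^sup>T D\<close> with \<open>D = B\<^bsub>S\<^sup>cS\<^esub> C\<close>. A bound \<open>c\<close> for the row sums of \<open>D\<close> is a bound for its
  operator norm with respect to the 1-norm of row vectors.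
\<close>

lemma left_kernel_bound:
  fixes B :: "real^'m^'m"
  assumes inv: "is_submat_inv S B C" and ker: "n v* B = 0"
    and bound: "row_sum_norm (submat (- S) S B ** C) \<le> c"
  shows "(\<Sum>s\<in>S. \<bar>n $ s\<bar>) \<le> c * (\<Sum>r\<in>- S. \<bar>n $ r\<bar>)"
proof -
  define D where "D = submat (- S) S B ** C"
  have split: "submat S S B + submat (- S) S B = submat UNIV S B"
    by (simp add: submat_def vec_eq_iff)
  have "(n v* submat UNIV S B) $ s = of_bool (s \<in> S) * (n v* B) $ s" for s
    by (cases "s \<in> S") (simp_all add: vector_matrix_mult_def submat_def)
  then have "n v* submat UNIV S B = 0"
    using ker by (simp add: vec_eq_iff)
  then have "(n v* (submat S S B + submat (- S) S B)) v* C = 0"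
    by (simp add: split)
  then have "n v* submat S S (mat 1) + n v* D = 0"
    using inv by (simp add: vector_matrix_mul_assoc vector_matrix_mult_add_rdistrib D_def
        vector_matrix_left_distrib is_submat_inv_def)
  then have "(n v* submat S S (mat 1)) $ s + (n v* D) $ s = 0" for s
    by (metis vector_add_component zero_index)
  moreover have "(n v* submat S S (mat 1)) $ s = of_bool (s \<in> S) * n $ s" for s
    by (simp add: submat_mat_1 vector_matrix_mult_def diagonal_def mult_delta_right)
  ultimately have "n $ s + (n v* D) $ s = 0" if "s \<in> S" for s
    using that by (metis mult_1 of_bool_eq(2))
  then have n: "n $ s = - (\<Sum>r\<in>UNIV. D $ r $ s * n $ r)" if "s \<in> S" for s
    using that by (simp add: vector_matrix_mult_def eq_neg_iff_add_eq_0 mult.commute)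
  have D0: "D $ r $ s = 0" if "r \<in> S" for r s
    using that by (simp add: D_def submat_def matrix_matrix_mult_def)
  have n': "\<bar>n $ s\<bar> \<le> (\<Sum>r\<in>- S. \<bar>n $ r\<bar> * \<bar>D $ r $ s\<bar>)" if "s \<in> S" for s
  proof -
    have "(\<Sum>r\<in>UNIV. D $ r $ s * n $ r) = (\<Sum>r\<in>- S. D $ r $ s * n $ r)"
      by (intro sum.mono_neutral_right) (auto simp: D0)
    then show ?thesis
      using n[OF that] sum_abs[of "\<lambda>r. D $ r $ s * n $ r" "- S"]
      by (simp add: abs_mult mult.commute)
  qed
  have "(\<Sum>s\<in>S. \<bar>n $ s\<bar>) \<le> (\<Sum>s\<in>S. \<Sum>r\<in>- S. \<bar>n $ r\<bar> * \<bar>D $ r $ s\<bar>)"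
    by (intro sum_mono n')
  also have "\<dots> = (\<Sum>r\<in>- S. \<bar>n $ r\<bar> * (\<Sum>s\<in>S. \<bar>D $ r $ s\<bar>))"
    by (subst sum.swap) (simp add: sum_distrib_left)
  also have "\<dots> \<le> (\<Sum>r\<in>- S. \<bar>n $ r\<bar> * c)"
  proof (intro sum_mono mult_left_mono)
    fix r
    have "(\<Sum>s\<in>S. \<bar>D $ r $ s\<bar>) \<le> (\<Sum>s\<in>UNIV. \<bar>D $ r $ s\<bar>)" by (intro sum_mono2) auto
    also have "\<dots> \<le> c" using bound by (simp add: row_sum_norm_le_iff D_def)
    finally show "(\<Sum>s\<in>S. \<bar>D $ r $ s\<bar>) \<le> c" .
  qed auto
  finally show ?thesis by (simp add: sum_distrib_left mult.commute)
qed

section \<open>The matrix \<open>\<Gamma>(\<Sigma>)\<close>\<close>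

lemma A_mat_nth:
  "A_mat \<Sigma> $ (j, k) $ (l, m) = of_bool (j = l) * \<Sigma> $ k $ m + of_bool (k = l) * \<Sigma> $ j $ m"
proof -
  have "(kron (mat 1) \<Sigma> ** commutation) $ (j, k) $ (l, m) = kron (mat 1) \<Sigma> $ (j, k) $ (m, l)"
    by (simp add: matrix_matrix_mult_def commutation_def mult_delta_right)
  then show ?thesis by (simp add: A_mat_def kron_def mat_def)
qed

lemma tendsto_Gamma_mat:
  assumes "(X \<longlongrightarrow> \<Sigma>) F"
  shows "((\<lambda>t. Gamma_mat (X t)) \<longlongrightarrow> Gamma_mat \<Sigma>) F"
proof -
  have "((\<lambda>t. A_mat (X t)) \<longlongrightarrow> A_mat \<Sigma>) F"
    unfolding tendsto_matrix_iff split_paired_All A_mat_nth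
    by (intro allI tendsto_intros assms)
  then have "((\<lambda>t. Gamma_mat (X t) $ r $ s) \<longlongrightarrow> Gamma_mat \<Sigma> $ r $ s) F" for r s
    unfolding Gamma_mat_def transpose_def matrix_matrix_mult_def vec_lambda_beta
    by (intro tendsto_intros)
  then show ?thesis by (simp add: tendsto_matrix_iff)
qed

text \<open>
  For diagonal \<open>\<Sigma>\<close>, the column \<open>(j, k)\<close> of \<open>A(\<Sigma>)\<close> is \<open>\<sigma> k\<close> times the vectorisation of
  \<open>E\<^sub>j\<^sub>k + E\<^sub>k\<^sub>j\<close>, so two columns are orthogonal unless their positions agree up to transposition.
\<close>

lemma Gamma_mat_diagonal:
  "Gamma_mat (diagonal \<sigma>) $ r $ s
   = 2 * \<sigma> (snd r) * \<sigma> (snd s) * (of_bool (r = s) + of_bool (r = prod.swap s))"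
proof -
  have A: "A_mat (diagonal \<sigma>) $ t $ r = \<sigma> (snd r) * (of_bool (t = r) + of_bool (t = prod.swap r))"
    for t r
    by (cases t; cases r) (auto simp: A_mat_nth diagonal_def)
  have "Gamma_mat (diagonal \<sigma>) $ r $ s
      = \<sigma> (snd r) * \<sigma> (snd s) * (\<Sum>t\<in>UNIV. (of_bool (t = r) + of_bool (t = prod.swap r)) *
          (of_bool (t = s) + of_bool (t = prod.swap s)))"
    by (simp add: Gamma_mat_def matrix_matrix_mult_def transpose_def A sum_distrib_left mult_ac)
  also have "(\<Sum>t\<in>UNIV. (of_bool (t = r) + of_bool (t = prod.swap r)) *
      (of_bool (t = s) + of_bool (t = prod.swap s)))
      = of_bool (r = s) + of_bool (r = prod.swap s)
        + (of_bool (prod.swap r = s) + of_bool (prod.swap r = prod.swap s) :: real)"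
    by (simp add: distrib_right sum.distrib)
  also have "\<dots> = 2 * (of_bool (r = s) + of_bool (r = prod.swap s))"
  proof -
    have "prod.swap r = s \<longleftrightarrow> r = prod.swap s" "prod.swap r = prod.swap s \<longleftrightarrow> r = s"
      by (metis swap_swap)+
    then show ?thesis by (simp only:) simp
  qed
  finally show ?thesis by simp
qed

text \<open>
  The kernel of the Gram matrix contains that of \<open>A(\<Sigma>)\<close>, which maps \<open>vec(N)\<close> to the vectorisation
  of the doubled symmetric part of \<open>N \<Sigma>\<close>.
\<close>

lemma left_kernel_Gamma_mat:
  assumes "transpose \<Sigma> = \<Sigma>" and "transpose (N ** \<Sigma>) = - (N ** \<Sigma>)"
  shows "vec_cols N v* Gamma_mat \<Sigma> = 0"
proof -
  have "N ** \<Sigma> + \<Sigma> ** transpose N = 0"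
    using assms by (simp add: matrix_transpose_mul)
  then have "A_mat \<Sigma> *v vec_cols N = 0"
    using assms(1) by (simp add: A_mat_vec_cols) (simp add: vec_cols_def vec_eq_iff)
  then show ?thesis
    by (simp add: Gamma_mat_def flip: vector_matrix_mul_assoc)
qed

section \<open>The criterion\<close>

lemma irrep_const_eq:
  assumes "is_submat_inv (supp M) (Gamma_mat (lyapunov_sol M)) C"
  shows "irrep_const M
    = row_sum_norm (submat (- supp M) (supp M) (Gamma_mat (lyapunov_sol M)) ** C)"
  using submat_inv_eq[OF assms] by (simp add: irrep_const_def Let_def)

lemma irrep_uniform_near_iff:
  "irrep_uniform_near S M0 \<longleftrightarrow>
    (\<exists>\<alpha>>0. \<forall>\<^sub>F M in nhds M0. M \<in> Stab \<and> (supp M = S \<longrightarrow> irrep_const_le M (1 - \<alpha>)))"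
proof
  assume "irrep_uniform_near S M0"
  then obtain U \<alpha> where "U \<subseteq> Stab" "M0 \<in> interior U" "\<alpha> > 0"
    "\<forall>M\<in>U. supp M = S \<longrightarrow> irrep_const_le M (1 - \<alpha>)"
    by (auto simp: irrep_uniform_near_def irrep_uniform_def)
  then have "\<forall>\<^sub>F M in nhds M0. M \<in> Stab \<and> (supp M = S \<longrightarrow> irrep_const_le M (1 - \<alpha>))"
    using eventually_nhds_in_open[of "interior U" M0] interior_subset[of U]
    by (auto elim!: eventually_mono)
  with \<open>\<alpha> > 0\<close>
  show "\<exists>\<alpha>>0. \<forall>\<^sub>F M in nhds M0. M \<in> Stab \<and> (supp M = S \<longrightarrow> irrep_const_le M (1 - \<alpha>))"
    by blast
next
  assume "\<exists>\<alpha>>0. \<forall>\<^sub>F M in nhds M0. M \<in> Stab \<and> (supp M = S \<longrightarrow> irrep_const_le M (1 - \<alpha>))"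
  then obtain \<alpha> U where "\<alpha> > 0" "open U" "M0 \<in> U"
    "\<forall>M\<in>U. M \<in> Stab \<and> (supp M = S \<longrightarrow> irrep_const_le M (1 - \<alpha>))"
    by (auto simp: eventually_nhds)
  then show "irrep_uniform_near S M0"
    unfolding irrep_uniform_near_def irrep_uniform_def
    by (intro exI[of _ U]) (auto simp: interior_open)
qed

text \<open>
  The kernel inequality is applied along the path \<open>M t = M\<^sup>0 + t T\<close>, which has support \<open>S\<close> for all
  \<open>t \<noteq> 0\<close>, and then passed to the limit \<open>t \<rightarrow> 0\<close>.
\<close>

lemma irrep_uniform_near_imp_less:
  fixes d :: "'n::finite \<Rightarrow> real"
  assumes d: "\<forall>i. d i > 0" and loops: "\<forall>i. (i, i) \<in> S"
    and irrep: "irrep_uniform_near S (diagonal (\<lambda>i. - d i))"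
    and jk: "(j, k) \<in> S" "j \<noteq> k"
  shows "d k < d j"
proof -
  let ?M0 = "diagonal (\<lambda>i. - d i) :: real^'n^'n"
  let ?\<Sigma>0 = "diagonal (\<lambda>i. 1 / d i) :: real^'n^'n"
  have d0: "d i \<noteq> 0" "d i \<ge> 0" for i using d[rule_format, of i] by simp_all
  obtain \<alpha> where \<alpha>: "\<alpha> > 0"
    "\<forall>\<^sub>F M in nhds ?M0. M \<in> Stab \<and> (supp M = S \<longrightarrow> irrep_const_le M (1 - \<alpha>))"
    using irrep by (auto simp: irrep_uniform_near_iff)
  define T :: "real^'n^'n" where "T = (\<chi> i l. of_bool ((i, l) \<in> S \<and> i \<noteq> l))"
  define M where "M t = ?M0 + t *\<^sub>R T" for t
  have "(M \<longlongrightarrow> ?M0 + 0 *\<^sub>R T) (at 0)"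
    unfolding M_def by (intro tendsto_intros)
  then have M: "filterlim M (nhds ?M0) (at 0)" by simp
  have supp: "supp (M t) = S" if "t \<noteq> 0" for t
    using loops that by (auto simp: supp_def M_def T_def diagonal_def d0)
  define \<Sigma> where "\<Sigma> t = lyapunov_sol (M t)" for t
  have \<Sigma>: "(\<Sigma> \<longlongrightarrow> ?\<Sigma>0) (at 0)" "\<forall>\<^sub>F t in at 0. transpose (\<Sigma> t) = \<Sigma> t"
    unfolding \<Sigma>_def
    by (rule filterlim_compose[OF lyapunov_sol_near_diagonal(2)[OF d] M],
        rule eventually_compose_filterlim[OF lyapunov_sol_near_diagonal(1)[OF d] M])
  define K :: "real^'n^'n" where
    "K = (\<chi> i l. if i = j \<and> l = k then 1 else if i = k \<and> l = j then - 1 else 0)"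
  have K: "transpose K = - K"
    using jk(2) by (auto simp: K_def transpose_def vec_eq_iff)
  have inj: "inj (\<lambda>N :: real^'n^'n. N ** ?\<Sigma>0)"
    by (intro inj_mult_diagonal) (simp add: d0)
  define N where "N t = inv (\<lambda>N :: real^'n^'n. N ** \<Sigma> t) K" for t
  have "\<forall>\<^sub>F t in at 0. bij (\<lambda>N :: real^'n^'n. N ** \<Sigma> t)"
    using eventually_bij_bilinear[OF bounded_bilinear_matrix_mult_flip inj] \<Sigma>(1)
    by (rule eventually_compose_filterlim)
  then have N: "\<forall>\<^sub>F t in at 0. N t ** \<Sigma> t = K"
    unfolding N_def by (rule eventually_mono) (rule bij_is_surj[THEN surj_f_inv_f])
  define N0 where "N0 = K ** diagonal d"
  have N0\<Sigma>: "N0 ** ?\<Sigma>0 = K"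
    by (simp add: N0_def vec_eq_iff matrix_mult_diagonal d0)
  have limN: "(N \<longlongrightarrow> N0) (at 0)"
    by (rule tendsto_solution[OF bounded_bilinear_matrix_mult_flip inj \<Sigma>(1) _ N])
      (simp add: N0\<Sigma>)
  have "\<forall>\<^sub>F t in at 0. M t \<in> Stab \<and> (supp (M t) = S \<longrightarrow> irrep_const_le (M t) (1 - \<alpha>))"
    using \<alpha>(2) M by (rule eventually_compose_filterlim)
  moreover have "\<forall>\<^sub>F t::real in at 0. t \<noteq> 0"
    by (simp add: eventually_at_filter)
  ultimately have "\<forall>\<^sub>F t in at 0. (\<Sum>s\<in>S. \<bar>vec_cols (N t) $ s\<bar>)
      \<le> (1 - \<alpha>) * (\<Sum>r\<in>- S. \<bar>vec_cols (N t) $ r\<bar>)"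
    using \<Sigma>(2) N
  proof eventually_elim
    case (elim t)
    then have "irrep_const_le (M t) (1 - \<alpha>)" using supp by blast
    then obtain C where C: "is_submat_inv S (Gamma_mat (\<Sigma> t)) C" and "irrep_const (M t) \<le> 1 - \<alpha>"
      using supp[OF elim(2)] by (auto simp: irrep_const_le_def submat_invertible_def \<Sigma>_def)
    then have "row_sum_norm (submat (- S) S (Gamma_mat (\<Sigma> t)) ** C) \<le> 1 - \<alpha>"
      using irrep_const_eq[of "M t" C] supp[OF elim(2)] by (simp add: \<Sigma>_def)
    moreover have "vec_cols (N t) v* Gamma_mat (\<Sigma> t) = 0"
      using elim K by (intro left_kernel_Gamma_mat) auto
    ultimately show ?case using C by (intro left_kernel_bound)
  qed
  then have le: "(\<Sum>s\<in>S. \<bar>vec_cols N0 $ s\<bar>) \<le> (1 - \<alpha>) * (\<Sum>r\<in>- S. \<bar>vec_cols N0 $ r\<bar>)"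
    by (rule tendsto_le[rotated 3])
      (auto simp: vec_cols_def intro!: tendsto_intros limN)
  have n: "vec_cols N0 $ r = (if r = (j, k) then d k else if r = (k, j) then - d j else 0)" for r
    by (cases r) (auto simp: vec_cols_def N0_def matrix_mult_diagonal K_def)
  \<comment> \<open>The limit inequality is \<open>d k \<le> (1 - \<alpha>) y\<close>, and \<open>y\<close> is \<open>d j\<close> or \<open>0\<close> according to whether
    \<open>(k, j)\<close> lies outside or inside \<open>S\<close>; the second case contradicts \<open>d k > 0\<close>.\<close>
  define y where "y = (\<Sum>r\<in>- S. \<bar>vec_cols N0 $ r\<bar>)"
  have "d k = \<bar>vec_cols N0 $ (j, k)\<bar>"
    by (simp add: n d0)
  also have "\<dots> \<le> (\<Sum>s\<in>S. \<bar>vec_cols N0 $ s\<bar>)"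
    by (rule member_le_sum[OF jk(1)]) auto
  also have "\<dots> \<le> (1 - \<alpha>) * y" using le by (simp add: y_def)
  finally have dk: "d k \<le> y - \<alpha> * y" by (simp add: algebra_simps)
  have "y \<ge> 0" by (auto simp: y_def sum_nonneg)
  moreover have "y \<noteq> 0" using dk d[rule_format, of k] by auto
  ultimately have "\<alpha> * y > 0" using \<alpha>(1) by simp
  with dk have "d k < y" by linarith
  have "\<bar>vec_cols N0 $ r\<bar> \<le> (if r = (k, j) then d j else 0)" if "r \<in> - S" for r
  proof -
    have "r \<noteq> (j, k)" using that jk(1) by blast
    then show ?thesis by (simp add: n d0(2))
  qed
  then have "y \<le> (\<Sum>r\<in>- S. if r = (k, j) then d j else 0)"
    unfolding y_def by (rule sum_mono)
  also have "\<dots> \<le> (\<Sum>r\<in>UNIV. if r = (k, j) then d j else 0)"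
    by (rule sum_mono2) (simp_all add: d0(2))
  also have "\<dots> = d j" by simp
  finally have "y \<le> d j" .
  with \<open>d k < y\<close> show ?thesis by simp
qed

text \<open>
  Monotonicity of \<open>d\<close> makes \<open>\<Gamma>\<^bsub>SS\<^esub>\<close> diagonal and nonsingular at \<open>\<Sigma>\<^sup>0\<close>, so that the matrix in the
  irrepresentability constant has a limit \<open>B0\<close> at \<open>M\<^sup>0\<close>; its row sums are quotients
  \<open>d k / d j < 1\<close> or \<open>0\<close>.
\<close>

lemma less_imp_irrep_uniform_near:
  fixes d :: "'n::finite \<Rightarrow> real"
  assumes d: "\<forall>i. d i > 0" and less: "\<And>j k. (j, k) \<in> S \<Longrightarrow> j \<noteq> k \<Longrightarrow> d k < d j"
  shows "irrep_uniform_near S (diagonal (\<lambda>i. - d i))"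
proof -
  let ?M0 = "diagonal (\<lambda>i. - d i) :: real^'n^'n"
  define \<sigma> where "\<sigma> i = 1 / d i" for i
  have \<sigma>: "\<sigma> i > 0" for i using d by (simp add: \<sigma>_def)
  then have \<sigma>0: "\<sigma> i \<noteq> 0" for i by (metis less_irrefl)
  define \<Gamma>0 where "\<Gamma>0 = Gamma_mat (diagonal \<sigma>)"
  have \<Gamma>0: "\<Gamma>0 $ r $ s
      = 2 * \<sigma> (snd r) * \<sigma> (snd s) * (of_bool (r = s) + of_bool (r = prod.swap s))" for r s
    unfolding \<Gamma>0_def by (rule Gamma_mat_diagonal)
  define \<Gamma> where "\<Gamma> M = Gamma_mat (lyapunov_sol M)" for M :: "real^'n^'n"
  have \<Gamma>: "(\<Gamma> \<longlongrightarrow> \<Gamma>0) (nhds ?M0)"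
    unfolding \<Gamma>_def \<Gamma>0_def \<sigma>_def
    by (rule tendsto_Gamma_mat[OF lyapunov_sol_near_diagonal(2)[OF d]])
  have lim_submat: "((\<lambda>M. submat I J (\<Gamma> M)) \<longlongrightarrow> submat I J \<Gamma>0) (nhds ?M0)" for I J
    using \<Gamma> by (auto simp: tendsto_matrix_iff submat_def)
  \<comment> \<open>A 2-cycle would require both \<open>d k < d j\<close> and \<open>d j < d k\<close>.\<close>
  have antisym: "prod.swap s \<notin> S" if "s \<in> S" "prod.swap s \<noteq> s" for s
    using less[of "fst s" "snd s"] less[of "snd s" "fst s"] that
    by (cases s) (force simp: prod.swap_def)
  define g where "g s = (if s \<in> S then \<Gamma>0 $ s $ s else 1)" for s
  have g: "bordered S \<Gamma>0 = diagonal g"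
    using antisym
    by (auto simp: bordered_def submat_def diagonal_def vec_eq_iff g_def mat_def \<Gamma>0)
  have "g s \<noteq> 0" for s
    by (simp add: g_def \<Gamma>0 \<sigma>0 of_bool_def)
  then have inj: "inj (\<lambda>B :: real^('n \<times> 'n)^('n \<times> 'n). B ** bordered S \<Gamma>0)"
    unfolding g by (rule inj_mult_diagonal)
  have lim_bordered: "((\<lambda>M. bordered S (\<Gamma> M)) \<longlongrightarrow> bordered S \<Gamma>0) (nhds ?M0)"
    unfolding bordered_def by (intro tendsto_intros lim_submat)
  define C where "C M = submat_inv S (\<Gamma> M)" for M
  have "\<forall>\<^sub>F M in nhds ?M0. bij (\<lambda>B :: real^('n \<times> 'n)^('n \<times> 'n). B ** bordered S (\<Gamma> M))"
    using eventually_bij_bilinear[OF bounded_bilinear_matrix_mult_flip inj] lim_bordered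
    by (rule eventually_compose_filterlim)
  then have inv: "\<forall>\<^sub>F M in nhds ?M0. is_submat_inv S (\<Gamma> M) (C M)"
  proof eventually_elim
    case (elim M)
    then obtain X where "mat 1 = X ** bordered S (\<Gamma> M)" by (metis bij_pointE)
    then show ?case
      unfolding C_def by (metis is_submat_inv_bordered submat_inv_eq)
  qed
  define B where "B M = submat (- S) S (\<Gamma> M) ** C M" for M
  \<comment> \<open>On \<open>S\<close>, the diagonal entry of \<open>\<Gamma>0\<close> at \<open>(j, k)\<close>, \<open>j \<noteq> k\<close>, is \<open>2 (\<sigma> k)\<^sup>2\<close>, and its entry in row
    \<open>(k, j)\<close> is \<open>2 \<sigma> j \<sigma> k\<close>; the entry of \<open>B0\<close> is their quotient \<open>\<sigma> j / \<sigma> k = d k / d j\<close>.\<close>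
  define B0 :: "real^('n \<times> 'n)^('n \<times> 'n)" where
    "B0 = (\<chi> r s. if r \<notin> S \<and> s \<in> S \<and> r = prod.swap s then \<sigma> (fst s) / \<sigma> (snd s) else 0)"
  have "B0 $ r $ s * g s = submat (- S) S \<Gamma>0 $ r $ s" for r s
  proof (cases "r \<notin> S \<and> s \<in> S")
    case True
    then have "r \<noteq> s" by blast
    with True show ?thesis
      by (cases "r = prod.swap s") (simp_all add: B0_def g_def submat_def \<Gamma>0 \<sigma>0)
  qed (auto simp: B0_def submat_def)
  then have B0: "B0 ** bordered S \<Gamma>0 = submat (- S) S \<Gamma>0"
    by (simp add: g vec_eq_iff matrix_mult_diagonal)
  have limB: "(B \<longlongrightarrow> B0) (nhds ?M0)"
  proof (rule tendsto_solution[OF bounded_bilinear_matrix_mult_flip inj lim_bordered])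
    show "((\<lambda>M. submat (- S) S (\<Gamma> M)) \<longlongrightarrow> B0 ** bordered S \<Gamma>0) (nhds ?M0)"
      unfolding B0 by (rule lim_submat)
    show "\<forall>\<^sub>F M in nhds ?M0. B M ** bordered S (\<Gamma> M) = submat (- S) S (\<Gamma> M)"
      using inv by (rule eventually_mono) (simp add: B_def submat_inv_mult_bordered)
  qed
  have row: "(\<Sum>s\<in>UNIV. \<bar>B0 $ r $ s\<bar>) < 1" for r
  proof -
    have "(\<Sum>s\<in>UNIV. \<bar>B0 $ r $ s\<bar>) = (\<Sum>s\<in>{prod.swap r}. \<bar>B0 $ r $ s\<bar>)"
      by (rule sum.mono_neutral_right) (auto simp: B0_def)
    also have "\<dots> < 1"
    proof (cases r)
      case (Pair k j)
      show ?thesis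
      proof (cases "(j, k) \<in> S \<and> (k, j) \<notin> S")
        case True
        then have "d k < d j" using less[of j k] by blast
        then show ?thesis
          using True Pair d[rule_format, of k] d[rule_format, of j]
          by (simp add: B0_def \<sigma>_def)
      qed (use Pair in \<open>auto simp: B0_def\<close>)
    qed
    finally show ?thesis .
  qed
  define m where "m = row_sum_norm B0"
  have "m \<in> range (\<lambda>r. \<Sum>s\<in>UNIV. \<bar>B0 $ r $ s\<bar>)"
    unfolding m_def row_sum_norm_def by (rule Max_in) auto
  then have m: "m < 1" using row by auto
  \<comment> \<open>The midpoint \<open>(1 + m) / 2 = 1 - \<alpha>\<close> with \<open>\<alpha> = (1 - m) / 2\<close> leaves room on both sides.\<close>
  have "\<forall>\<^sub>F M in nhds ?M0. (\<Sum>s\<in>UNIV. \<bar>B M $ r $ s\<bar>) < (1 + m) / 2" for r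
  proof (rule order_tendstoD(2))
    show "((\<lambda>M. \<Sum>s\<in>UNIV. \<bar>B M $ r $ s\<bar>) \<longlongrightarrow> (\<Sum>s\<in>UNIV. \<bar>B0 $ r $ s\<bar>)) (nhds ?M0)"
      by (intro tendsto_intros limB)
    have "(\<Sum>s\<in>UNIV. \<bar>B0 $ r $ s\<bar>) \<le> m"
      unfolding m_def by (rule row_sum_norm_le_iff[THEN iffD1, OF order_refl, THEN spec])
    then show "(\<Sum>s\<in>UNIV. \<bar>B0 $ r $ s\<bar>) < (1 + m) / 2" using m by simp
  qed
  then have "\<forall>\<^sub>F M in nhds ?M0. \<forall>r. (\<Sum>s\<in>UNIV. \<bar>B M $ r $ s\<bar>) < (1 + m) / 2"
    by (rule eventually_all_finite)
  with inv eventually_Stab_diagonal[OF d]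
  have "\<forall>\<^sub>F M in nhds ?M0. M \<in> Stab \<and> (supp M = S \<longrightarrow> irrep_const_le M (1 - (1 - m) / 2))"
  proof eventually_elim
    case (elim M)
    have "irrep_const_le M (1 - (1 - m) / 2)" if S: "supp M = S"
    proof -
      have "irrep_const M = row_sum_norm (B M)"
        using irrep_const_eq[of M "C M"] elim(1) by (simp add: S B_def \<Gamma>_def)
      also have "\<dots> \<le> (1 + m) / 2"
        unfolding row_sum_norm_le_iff using elim(3) less_imp_le by blast
      also have "(1 + m) / 2 = 1 - (1 - m) / 2"
        by (simp add: field_simps)
      finally show ?thesis
        using elim(1) by (auto simp: irrep_const_le_def submat_invertible_def S \<Gamma>_def)
    qed
    with elim(2) show ?case by blast
  qed
  moreover have "(1 - m) / 2 > 0" using m by simp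
  ultimately show ?thesis
    unfolding irrep_uniform_near_iff by blast
qed

lemma acyclic_strict_potential:
  fixes d :: "'a \<Rightarrow> 'b::preorder"
  assumes "\<And>i j. (i, j) \<in> R \<Longrightarrow> d i < d j"
  shows "acyclic R"
proof -
  have "d i < d j" if "(i, j) \<in> R\<^sup>+" for i j
    using that by induction (auto dest: assms intro: less_trans)
  then show ?thesis by (auto simp: acyclic_def)
qed

theorem theorem4p2:
  fixes E :: "('n::finite \<times> 'n) set" and d :: "'n \<Rightarrow> real"
  assumes "\<forall>i. (i, i) \<in> E"
    and "\<forall>i. d i > 0"
  shows "(irrep_uniform_near (graph_supp E) (diagonal (\<lambda>i. - d i))
            \<longleftrightarrow> (\<forall>i j. (i, j) \<in> E \<and> i \<noteq> j \<longrightarrow> d i < d j))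
       \<and> (irrep_uniform_near (graph_supp E) (diagonal (\<lambda>i. - d i)) \<longrightarrow> acyclic (E - Id))"
proof -
  have S: "(j, i) \<in> graph_supp E \<longleftrightarrow> (i, j) \<in> E" for i j
    by (auto simp: graph_supp_def)
  have iff: "irrep_uniform_near (graph_supp E) (diagonal (\<lambda>i. - d i))
      \<longleftrightarrow> (\<forall>i j. (i, j) \<in> E \<and> i \<noteq> j \<longrightarrow> d i < d j)"
    using irrep_uniform_near_imp_less[OF assms(2), of "graph_supp E"]
      less_imp_irrep_uniform_near[OF assms(2), of "graph_supp E"] assms(1)
    by (metis S)
  moreover have "acyclic (E - Id)" if "\<forall>i j. (i, j) \<in> E \<and> i \<noteq> j \<longrightarrow> d i < d j"
    by (rule acyclic_strict_potential[of _ d]) (use that in auto)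
  ultimately show ?thesis by blast
qed

end
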